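(* Let $\boldsymbol{\xi}\in\mathbb{R}^{n\times m}$ be totally irrational and satisfy property (C). (1) If $n\ge 2$ and $m=1$, then $\omega(\boldsymbol{\xi})\le 1$. (2) If $n\ge 2$ and $m=2$, then $\omega(\boldsymbol{\xi})\le 2$. (3) If $n\ge 2$ and $m\ge 3$, then $\omega(\boldsymbol{\xi})<\infty$.
   Context: All norms are sup-norms. For $\mathbf{x}=(\boldsymbol{x},\boldsymbol{y})\in\mathbb{Z}^{m+n}$ put $L_{\boldsymbol{\xi}}(\mathbf{x})=\|\boldsymbol{\xi}\boldsymbol{x}-\boldsymbol{y}\|$; $\boldsymbol{\xi}$ is totally irrational if $L_{\boldsymbol{\xi}}(\mathbf{x})>0$ for all nonzero integer $\mathbf{x}$. The step function $X\mapsto\min\{L_{\boldsymbol{\xi}}(\boldsymbol{x},\boldsymbol{y}): 0<\|\boldsymbol{x}\|\le X\}$ (minimum over integer vectors) has successive jump points $1=X_1<X_2<\cdots$ and value $L_i$ on $[X_i,X_{i+1})$. Property (C): $\sup_iL_i/L_{i+1}<\infty$. The ordinary exponent $\omega(\boldsymbol{\xi})$ is the supremum of $w$ such that $L_{\boldsymbol{\xi}}(\mathbf{x})<X^{-w}$, $0<\|\boldsymbol{x}\|\le X$ has integer solutions for arbitrarily large $X$; equivalently $\omega(\boldsymbol{\xi})=\limsup_i(-\log L_i)/\log X_i$. *)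

theory Defs
  imports "HOL-Analysis.Analysis"
begin

text \<open>
  An n-by-m real matrix is a value of type \<open>real ^ 'm ^ 'n\<close>, with \<open>n = CARD('n)\<close> and
  \<open>m = CARD('m)\<close>. On \<open>real ^ 'k\<close> the library's \<^const>\<open>infnorm\<close> is the sup-norm.
\<close>

definition real_vec :: "int ^ 'k \<Rightarrow> real ^ 'k" where
  "real_vec x = (\<chi> i. real_of_int (x $ i))"

definition lin_err :: "real ^ 'm ^ 'n \<Rightarrow> int ^ 'm \<Rightarrow> int ^ 'n \<Rightarrow> real" where
  "lin_err \<xi> x y = infnorm (\<xi> *v real_vec x - real_vec y)"

definition totally_irrational :: "real ^ 'm ^ 'n \<Rightarrow> bool" where
  "totally_irrational \<xi> \<longleftrightarrow> (\<forall>x y. (x, y) \<noteq> (0, 0) \<longrightarrow> 0 < lin_err \<xi> x y)"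

text \<open>
  For \<open>X \<ge> 1\<close> the infimum below is a minimum: only finitely many integer vectors \<open>x\<close> have
  sup-norm at most \<open>X\<close>, and for each of them only finitely many \<open>y\<close> keep the error bounded.
  For \<open>X < 1\<close> the set is empty and the value is irrelevant.
\<close>

definition min_err :: "real ^ 'm ^ 'n \<Rightarrow> real \<Rightarrow> real" where
  "min_err \<xi> X =
     Inf {lin_err \<xi> x y | x y. 0 < infnorm (real_vec x) \<and> infnorm (real_vec x) \<le> X}"

text \<open>
  The sequences are indexed from 0, so \<open>jump_point \<xi> i\<close> and \<open>jump_val \<xi> i\<close> are \<open>X\<close> and \<open>L\<close> with
  index \<open>i + 1\<close>. The step function is nonincreasing and changes only at integers, hence the least
  point after a jump where it has a smaller value exists as soon as there is any such point; there
  always is one when \<open>\<xi>\<close> is totally irrational, since the step function is then positive and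
  tends to 0 by Dirichlet's theorem.
\<close>

primrec jump_point :: "real ^ 'm ^ 'n \<Rightarrow> nat \<Rightarrow> real" where
  "jump_point \<xi> 0 = 1"
| "jump_point \<xi> (Suc i) =
     (LEAST X. jump_point \<xi> i < X \<and> min_err \<xi> X < min_err \<xi> (jump_point \<xi> i))"

definition jump_val :: "real ^ 'm ^ 'n \<Rightarrow> nat \<Rightarrow> real" where
  "jump_val \<xi> i = min_err \<xi> (jump_point \<xi> i)"

definition property_C :: "real ^ 'm ^ 'n \<Rightarrow> bool" where
  "property_C \<xi> \<longleftrightarrow> bdd_above (range (\<lambda>i. jump_val \<xi> i / jump_val \<xi> (Suc i)))"

text \<open>The exponent is extended-real valued because it may be infinite.\<close>

definition ordinary_exponent :: "real ^ 'm ^ 'n \<Rightarrow> ereal" where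
  "ordinary_exponent \<xi> =
     Sup (ereal ` {w. \<exists>\<^sub>F X in at_top. \<exists>x y. lin_err \<xi> x y < X powr (- w) \<and>
                        0 < infnorm (real_vec x) \<and> infnorm (real_vec x) \<le> X})"

end

theory Submission imports Defs begin

text \<open>
  Let \<open>X i\<close> and \<open>L i\<close> be the height and the error of the \<open>i\<close>-th best approximation, with
  \<open>L i \<le> C * L (i + 1)\<close>. An error bound \<open>L i \<ge> c * X i powr - \<mu>\<close> for all \<open>i\<close> gives
  \<open>\<omega> \<le> \<mu>\<close>. The heights grow geometrically while the errors decay at most geometrically, so some
  \<open>\<mu>\<close> works. If \<open>m = 1\<close>, eliminating the single coordinate of \<open>x\<close> from two consecutive
  approximations leaves a nonzero integer vector \<open>y\<close>, so \<open>2 * X (i + 1) * L i \<ge> 1\<close> and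
  \<open>\<mu> = 1\<close> works.

  If \<open>m = 2\<close>, take the longest block of consecutive approximations ending at \<open>i\<close> that lies in a
  plane, starting at \<open>j\<close>, say. The approximation before the block is outside the plane, so
  \<open>X j * X (j + 1) * L (j - 1)\<close> is bounded below. Any two neighbours in the block form a basis of
  the same lattice, so the minors built from one coordinate of \<open>x\<close> and one of the error agree
  along the block up to sign; hence \<open>X (j + 1) * L j\<close> is at most a constant times
  \<open>X i * L (i - 1)\<close>. Together, \<open>L i * X i ^ 2\<close> is bounded below.
\<close>

section \<open>Sup-norms of integer vectors and the error vector\<close>

abbreviation height :: "int ^ 'k \<Rightarrow> real" where
  "height x \<equiv> infnorm (real_vec x)"

text \<open>The error is kept as a vector because, unlike its norm, it is additive in the pair
  \<open>(x, y)\<close>.\<close>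

definition err :: "real ^ 'm ^ 'n \<Rightarrow> int ^ 'm \<Rightarrow> int ^ 'n \<Rightarrow> real ^ 'n" where
  "err \<xi> x y = \<xi> *v real_vec x - real_vec y"

lemma lin_err_eq: "lin_err \<xi> x y = infnorm (err \<xi> x y)"
  by (simp add: lin_err_def err_def)

lemma lin_err_nonneg: "0 \<le> lin_err \<xi> x y"
  by (simp add: lin_err_eq infnorm_pos_le)

lemma real_vec_nth [simp]: "real_vec x $ i = real_of_int (x $ i)"
  by (simp add: real_vec_def)

lemma real_vec_add: "real_vec (x + y) = real_vec x + real_vec y"
  and real_vec_diff: "real_vec (x - y) = real_vec x - real_vec y"
  and real_vec_scale: "real_vec (a *s x) = real_of_int a *\<^sub>R real_vec x"
  and real_vec_0 [simp]: "real_vec 0 = 0"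
  by (simp_all add: vec_eq_iff)

lemma real_vec_eq_0_iff [simp]: "real_vec x = 0 \<longleftrightarrow> x = 0"
  by (simp add: vec_eq_iff)

lemma err_add: "err \<xi> (x + x') (y + y') = err \<xi> x y + err \<xi> x' y'"
  and err_diff: "err \<xi> (x - x') (y - y') = err \<xi> x y - err \<xi> x' y'"
  and err_scale: "err \<xi> (a *s x) (a *s y) = real_of_int a *\<^sub>R err \<xi> x y"
  by (simp_all add: err_def real_vec_add real_vec_diff real_vec_scale algebra_simps
      matrix_vector_mult_scaleR)

lemma infnorm_cart_attained:
  fixes v :: "real ^ 'k"
  obtains i where "infnorm v = \<bar>v $ i\<bar>"
proof -
  have "infnorm v = Max (range (\<lambda>i. \<bar>v $ i\<bar>))"
    unfolding infnorm_cart by (subst cSup_eq_Max [symmetric]) (auto simp: full_SetCompr_eq)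
  also have "\<dots> \<in> range (\<lambda>i. \<bar>v $ i\<bar>)"
    by (rule Max_in) auto
  finally show thesis
    using that by auto
qed

lemma infnorm_cart_le_iff:
  fixes v :: "real ^ 'k"
  shows "infnorm v \<le> r \<longleftrightarrow> (\<forall>i. \<bar>v $ i\<bar> \<le> r)"
  by (metis component_le_infnorm_cart infnorm_cart_attained order_trans)

lemma infnorm_cart_less_iff:
  fixes v :: "real ^ 'k"
  shows "infnorm v < r \<longleftrightarrow> (\<forall>i. \<bar>v $ i\<bar> < r)"
  by (metis component_le_infnorm_cart infnorm_cart_attained le_less_trans)

lemma infnorm_diff_le:
  "infnorm (x - y) \<le> infnorm x + infnorm (y :: 'a :: euclidean_space)"
  using infnorm_triangle [of x "- y"] by (simp add: infnorm_neg)

lemma height_int: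
  obtains N :: nat where "height x = real N"
proof -
  obtain i where "height x = \<bar>real_vec x $ i\<bar>"
    by (rule infnorm_cart_attained)
  then have "height x = real (nat \<bar>x $ i\<bar>)"
    by simp
  then show thesis
    using that by blast
qed

lemma height_less_1: "height x < 1 \<Longrightarrow> x = 0"
  by (rule height_int [of x]) (simp add: infnorm_eq_0)

lemma height_axis: "height (axis s q) = \<bar>real_of_int q\<bar>"
proof (rule antisym)
  show "height (axis s q) \<le> \<bar>real_of_int q\<bar>"
    by (auto simp: infnorm_cart_le_iff axis_def)
  show "\<bar>real_of_int q\<bar> \<le> height (axis s q)"
    using component_le_infnorm_cart [of "real_vec (axis s q)" s] by (simp add: axis_def)
qed

text \<open>Used after eliminating the \<open>x\<close>-part: what remains is an integer vector
  whose height is an error, so an error below 1 forces it to vanish.\<close>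

lemma lin_err_0: "lin_err \<xi> 0 v = height v"
  by (simp add: lin_err_def infnorm_neg)

section \<open>Finiteness and attainment of the minimal error\<close>

lemma finite_int_vec_bounded: "finite {x :: int ^ 'k. height x \<le> B}"
proof (rule finite_subset)
  let ?I = "{- \<lceil>B\<rceil> .. \<lceil>B\<rceil>}"
  show "finite (vec_lambda ` (UNIV \<rightarrow>\<^sub>E ?I) :: (int ^ 'k) set)"
    by (intro finite_imageI finite_PiE) auto
  show "{x :: int ^ 'k. height x \<le> B} \<subseteq> vec_lambda ` (UNIV \<rightarrow>\<^sub>E ?I)"
  proof
    fix x :: "int ^ 'k" assume "x \<in> {x. height x \<le> B}"
    then have B: "\<bar>real_of_int (x $ i)\<bar> \<le> B" for i
      by (simp add: infnorm_cart_le_iff)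
    have "x $ i \<in> ?I" for i
      using B [of i] by (simp add: abs_le_iff) linarith
    then have "(\<lambda>i. x $ i) \<in> UNIV \<rightarrow>\<^sub>E ?I"
      by (simp add: PiE_UNIV_domain)
    then show "x \<in> vec_lambda ` (UNIV \<rightarrow>\<^sub>E ?I)"
      by (rule rev_image_eqI) simp
  qed
qed

lemma finite_lin_err_bounded: "finite {(x, y). height x \<le> X \<and> lin_err \<xi> x y \<le> B}"
proof -
  let ?F = "{x :: int ^ 'm. height x \<le> X}"
  have "finite (\<Union>x\<in>?F. Pair x ` {y :: int ^ 'n. height y \<le> B + infnorm (\<xi> *v real_vec x)})"
    by (intro finite_UN_I finite_imageI finite_int_vec_bounded)
  moreover have "height y \<le> B + infnorm (\<xi> *v real_vec x)" if "lin_err \<xi> x y \<le> B" for x y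
    using infnorm_diff_le [of "\<xi> *v real_vec x" "\<xi> *v real_vec x - real_vec y"] that
    by (simp add: lin_err_def)
  then have "{(x, y). height x \<le> X \<and> lin_err \<xi> x y \<le> B} \<subseteq>
      (\<Union>x\<in>?F. Pair x ` {y. height y \<le> B + infnorm (\<xi> *v real_vec x)})"
    by auto
  ultimately show ?thesis
    by (rule rev_finite_subset)
qed

lemma min_err_le: "0 < height x \<Longrightarrow> height x \<le> X \<Longrightarrow> min_err \<xi> X \<le> lin_err \<xi> x y"
  unfolding min_err_def by (rule cInf_lower) (auto intro!: bdd_belowI lin_err_nonneg)

lemma min_err_attained:
  fixes \<xi> :: "real ^ 'm ^ 'n"
  assumes "X \<ge> 1"
  obtains x y where "0 < height x" "height x \<le> X" "min_err \<xi> X = lin_err \<xi> x y"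
proof -
  obtain s :: 'm where True by blast
  \<comment> \<open>A unit vector has height 1, so it is admissible and its error can serve as a
    cutoff: pairs above it are never minimal, and only finitely many lie below.\<close>
  define B where "B = lin_err \<xi> (axis s 1) 0"
  let ?P = "{(x, y). (0 < height x \<and> height x \<le> X) \<and> lin_err \<xi> x y \<le> B}"
  have "finite ?P"
    by (rule finite_subset [OF _ finite_lin_err_bounded [of X \<xi> B]]) auto
  moreover have "(axis s 1, 0) \<in> ?P"
    using assms by (simp add: B_def height_axis)
  then have "?P \<noteq> {}"
    by blast
  ultimately obtain p where "is_arg_min (case_prod (lin_err \<xi>)) (\<lambda>p. p \<in> ?P) p"
    using ex_is_arg_min_if_finite by blast
  then obtain x y where xy: "0 < height x" "height x \<le> X" "lin_err \<xi> x y \<le> B"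
    and min: "\<And>u v. 0 < height u \<Longrightarrow> height u \<le> X \<Longrightarrow> lin_err \<xi> u v \<le> B \<Longrightarrow>
      lin_err \<xi> x y \<le> lin_err \<xi> u v"
    by (cases p) (fastforce simp: is_arg_min_linorder)
  have "lin_err \<xi> x y \<le> lin_err \<xi> u v" if "0 < height u" "height u \<le> X" for u v
    using min [of u v] that xy(3) by linarith
  then have "min_err \<xi> X = lin_err \<xi> x y"
    unfolding min_err_def using xy by (intro cInf_eq_minimum) auto
  with xy show thesis
    using that by blast
qed

section \<open>Small errors from a single column\<close>

lemma matrix_mult_axis:
  "(\<xi> *v real_vec (axis s q)) $ t = of_int q * \<xi> $ t $ s"
  by (simp add: matrix_vector_mult_def axis_def if_distrib [of real_of_int]
      if_distrib [of "\<lambda>z. _ * z"] mult.commute cong: if_cong)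

text \<open>Taking \<open>x\<close> to be a multiple of a unit vector reduces this to simultaneous
  Dirichlet approximation of the entries of one column.\<close>

lemma lin_err_arbitrarily_small:
  fixes \<xi> :: "real ^ 'm ^ 'n"
  assumes "\<epsilon> > 0"
  obtains x y where "0 < height x" "lin_err \<xi> x y < \<epsilon>"
proof -
  obtain s :: 'm where True by blast
  \<comment> \<open>Dirichlet's theorem numbers the reals to be approximated by naturals, so the
    rows are enumerated by \<open>f\<close>.\<close>
  obtain f :: "nat \<Rightarrow> 'n" where f: "bij_betw f {..<CARD('n)} UNIV"
    by (metis atLeast0LessThan ex_bij_betw_nat_finite finite)
  obtain N :: nat where N: "N > 0" "1 / real N < \<epsilon>"
    using assms by (metis nat_approx_posE of_nat_Suc zero_less_Suc)
  obtain q p where q: "0 < q"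
    and p: "\<And>i. i < CARD('n) \<Longrightarrow> \<bar>of_int q * \<xi> $ (f i) $ s - of_int (p i)\<bar> < 1 / N"
    by (rule Dirichlet_approx_simult [OF N(1), of "CARD('n)" "\<lambda>i. \<xi> $ (f i) $ s"]) blast
  define y where "y = (\<chi> t. p (the_inv_into {..<CARD('n)} f t))"
  have "\<bar>err \<xi> (axis s q) y $ t\<bar> < \<epsilon>" for t
  proof -
    obtain i where i: "i < CARD('n)" "t = f i"
      using f by (metis UNIV_I bij_betw_imp_surj_on imageE lessThan_iff)
    then have "y $ t = p i"
      using f by (simp add: y_def the_inv_into_f_f bij_betw_def)
    then show ?thesis
      using p [OF i(1)] i N(2) by (simp add: err_def matrix_mult_axis)
  qed
  then have "lin_err \<xi> (axis s q) y < \<epsilon>"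
    by (simp add: lin_err_eq infnorm_cart_less_iff)
  then show thesis
    using that [of "axis s q"] q by (simp add: height_axis)
qed

text \<open>Rounding a column leaves an error of at most 1/2. Consequently every minimal error stays
  below 1, the least height of a nonzero integer vector.\<close>

lemma min_err_1_less_1:
  fixes \<xi> :: "real ^ 'm ^ 'n"
  shows "min_err \<xi> 1 < 1"
proof -
  obtain s :: 'm where True by blast
  define y where "y = (\<chi> t. round (\<xi> $ t $ s))"
  have "\<bar>err \<xi> (axis s 1) y $ t\<bar> < 1" for t
    using of_int_round_abs_le [of "\<xi> $ t $ s"]
    by (simp add: err_def matrix_mult_axis y_def abs_minus_commute)
  then have "lin_err \<xi> (axis s 1) y < 1"
    by (simp add: lin_err_eq infnorm_cart_less_iff)
  then show ?thesis
    using min_err_le [of "axis s 1" 1 \<xi> y] by (simp add: height_axis)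
qed

lemma min_err_pos:
  assumes "totally_irrational \<xi>" "X \<ge> 1"
  shows "0 < min_err \<xi> X"
proof -
  obtain x y where "0 < height x" "min_err \<xi> X = lin_err \<xi> x y"
    by (rule min_err_attained [OF assms(2)])
  then show ?thesis
    using assms(1) by (force simp: totally_irrational_def infnorm_pos_lt)
qed

section \<open>Jump points are well defined\<close>

text \<open>\<open>LEAST\<close> over the reals is meaningful only once a minimum is exhibited. It
  is \<open>N\<close>, the least height of a vector with error below \<open>min_err \<xi> X\<close>:
  such vectors exist because errors become arbitrarily small, and heights are natural
  numbers.\<close>

lemma Least_jump:
  fixes \<xi> :: "real ^ 'm ^ 'n" and X :: real
  defines "Y \<equiv> LEAST Y. X < Y \<and> min_err \<xi> Y < min_err \<xi> X"
  assumes "totally_irrational \<xi>" "X \<ge> 1"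
  shows "X < Y" "min_err \<xi> Y < min_err \<xi> X"
    and "\<And>u v. 0 < height u \<Longrightarrow> height u < Y \<Longrightarrow> min_err \<xi> X \<le> lin_err \<xi> u v"
proof -
  let ?Q = "\<lambda>N :: nat. \<exists>x y. height x = real N \<and> 0 < height x \<and> lin_err \<xi> x y < min_err \<xi> X"
  define N where "N = (LEAST N. ?Q N)"
  obtain x0 y0 where "0 < height x0" "lin_err \<xi> x0 y0 < min_err \<xi> X"
    by (rule lin_err_arbitrarily_small [OF min_err_pos [OF assms(2,3)]])
  moreover obtain N0 :: nat where "height x0 = N0"
    by (rule height_int)
  ultimately have "?Q N0"
    by metis
  then have "?Q N"
    unfolding N_def by (rule LeastI [of ?Q])
  then obtain x y where x: "height x = N" "0 < height x" "lin_err \<xi> x y < min_err \<xi> X"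
    by blast
  have N_le: "real N \<le> height u" if u: "0 < height u" "lin_err \<xi> u v < min_err \<xi> X" for u v
  proof -
    obtain M :: nat where "height u = M"
      by (rule height_int)
    with u have "?Q M"
      by metis
    with \<open>height u = M\<close> show ?thesis
      unfolding N_def by (simp add: Least_le)
  qed
  have "X < N"
    using min_err_le [of x X \<xi> y] x by linarith
  moreover have "min_err \<xi> N < min_err \<xi> X"
    using min_err_le [of x N \<xi> y] x by linarith
  moreover have "real N \<le> Z" if Z: "X < Z" "min_err \<xi> Z < min_err \<xi> X" for Z
  proof -
    obtain u v where "0 < height u" "height u \<le> Z" "min_err \<xi> Z = lin_err \<xi> u v"
      using min_err_attained [of Z \<xi>] Z(1) assms(3) by auto
    then show ?thesis
      using N_le [of u v] Z(2) by simp
  qed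
  ultimately have "Y = N"
    unfolding Y_def by (intro Least_equality) auto
  then show "X < Y" "min_err \<xi> Y < min_err \<xi> X"
    "\<And>u v. 0 < height u \<Longrightarrow> height u < Y \<Longrightarrow> min_err \<xi> X \<le> lin_err \<xi> u v"
    using \<open>X < N\<close> \<open>min_err \<xi> N < min_err \<xi> X\<close> N_le by (simp_all) (meson not_le)
qed

section \<open>Sequences of best approximations\<close>

text \<open>Isolates what is needed from the jump points, free of \<open>Inf\<close> and
  \<open>LEAST\<close>. Property (C) enters as \<open>ratio\<close>.\<close>

locale best_approximations =
  fixes \<xi> :: "real ^ 'm ^ 'n" and x :: "nat \<Rightarrow> int ^ 'm" and y :: "nat \<Rightarrow> int ^ 'n"
    and C :: real
  assumes height_0: "height (x 0) = 1"
    and height_Suc: "height (x i) < height (x (Suc i))"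
    and lin_err_Suc: "lin_err \<xi> (x (Suc i)) (y (Suc i)) < lin_err \<xi> (x i) (y i)"
    and lin_err_pos: "0 < lin_err \<xi> (x i) (y i)"
    and lin_err_0_less_1: "lin_err \<xi> (x 0) (y 0) < 1"
    and best: "0 < height u \<Longrightarrow> height u < height (x (Suc i)) \<Longrightarrow>
      lin_err \<xi> (x i) (y i) \<le> lin_err \<xi> u v"
    and ratio: "lin_err \<xi> (x i) (y i) \<le> C * lin_err \<xi> (x (Suc i)) (y (Suc i))"
begin

abbreviation X :: "nat \<Rightarrow> real" where "X i \<equiv> height (x i)"
abbreviation e :: "nat \<Rightarrow> real ^ 'n" where "e i \<equiv> err \<xi> (x i) (y i)"
definition L :: "nat \<Rightarrow> real" where "L i = lin_err \<xi> (x i) (y i)"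

lemma infnorm_e: "infnorm (e i) = L i"
  by (simp add: L_def lin_err_eq)

lemma L_pos: "0 < L i"
  using lin_err_pos by (simp add: L_def)

lemma L_less: "i < j \<Longrightarrow> L j < L i"
  using lift_Suc_mono_less [of "\<lambda>i. - L i"] by (simp add: L_def lin_err_Suc)

lemma L_le: "i \<le> j \<Longrightarrow> L j \<le> L i"
  using L_less [of i j] by (cases "i = j") auto

lemma L_less_1: "L i < 1"
  using L_le [of 0 i] lin_err_0_less_1 by (simp add: L_def)

lemma X_less: "i < j \<Longrightarrow> X i < X j"
  by (rule strict_monoD [of X]) (simp_all add: strict_mono_Suc_iff height_Suc)

lemma X_le: "i \<le> j \<Longrightarrow> X i \<le> X j"
  using X_less [of i j] by (cases "i = j") auto

lemma X_ge_1: "1 \<le> X i"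
  using X_le [of 0 i] by (simp add: height_0)

lemma X_pos: "0 < X i"
  using X_ge_1 [of i] by linarith

lemma C_ge_1: "1 \<le> C"
proof (rule ccontr)
  assume "\<not> 1 \<le> C"
  then have "C * L (Suc 0) \<le> 1 * L (Suc 0)"
    using L_pos [of "Suc 0"] by (intro mult_right_mono) auto
  then show False
    using ratio [of 0] L_less [of 0 "Suc 0"] by (simp add: L_def)
qed

lemma L_ratio: "L i \<le> C * L (Suc i)"
  using ratio by (simp add: L_def)

lemma L_ratio_power: "L j \<le> C ^ k * L (j + k)"
proof (induction k)
  case (Suc k)
  have "C ^ k * L (j + k) \<le> C ^ k * (C * L (j + Suc k))"
    using L_ratio [of "j + k"] C_ge_1 by (intro mult_left_mono) auto
  with Suc show ?case
    by (simp add: mult.assoc mult.left_commute)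
qed auto

lemma L_ratio_power': "j \<le> i \<Longrightarrow> i \<le> j + k \<Longrightarrow> L j \<le> C ^ k * L i"
proof -
  assume "j \<le> i" "i \<le> j + k"
  then have "L j \<le> C ^ (i - j) * L i"
    using L_ratio_power [of j "i - j"] by simp
  also have "\<dots> \<le> C ^ k * L i"
    using \<open>i \<le> j + k\<close> C_ge_1 L_pos [of i] by (intro mult_right_mono power_increasing) auto
  finally show ?thesis .
qed

text \<open>A nonzero \<open>u\<close> would contradict \<open>best\<close>. Once
  \<open>u = 0\<close>, the error is the height of \<open>v\<close>, an integer below
  \<open>L i < 1\<close>.\<close>

lemma eq_0_if_small:
  assumes "height u < X (Suc i)" "lin_err \<xi> u v < L i"
  shows "u = 0" "v = 0"
proof -
  show "u = 0"
    using best [of u i v] assms by (force simp: L_def infnorm_pos_lt)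
  then have "height v < 1"
    using assms(2) L_less_1 [of i] by (simp add: lin_err_0)
  then show "v = 0"
    by (rule height_less_1)
qed

text \<open>A dependence would scale heights and errors by the same factor, whereas from
  \<open>i\<close> to \<open>Suc i\<close> heights increase and errors decrease.\<close>

lemma consecutive_independent:
  assumes "p *s x i = q *s x (Suc i)" "p *s y i = q *s y (Suc i)"
  shows "p = 0" "q = 0"
proof -
  have X: "\<bar>real_of_int p\<bar> * X i = \<bar>real_of_int q\<bar> * X (Suc i)"
    using assms(1) by (metis infnorm_mul real_vec_scale)
  have L: "\<bar>real_of_int p\<bar> * L i = \<bar>real_of_int q\<bar> * L (Suc i)"
    unfolding infnorm_e [symmetric] infnorm_mul [symmetric] err_scale [symmetric]
    by (simp add: assms)
  show q: "q = 0"
  proof (rule ccontr)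
    assume q: "q \<noteq> 0"
    have "\<bar>real_of_int p\<bar> * X i * L (Suc i) = \<bar>real_of_int p\<bar> * L i * X (Suc i)"
      by (simp add: X L)
    moreover have "p \<noteq> 0"
      using X q X_pos [of "Suc i"] by auto
    ultimately have "X i * L (Suc i) = X (Suc i) * L i"
      by simp
    moreover have "X i * L (Suc i) < X (Suc i) * L i"
      using L_less [of i "Suc i"] X_less [of i "Suc i"] X_pos [of i] L_pos [of "Suc i"]
      by (intro mult_strict_mono) auto
    ultimately show False
      by simp
  qed
  show "p = 0"
    using X q X_pos [of i] by simp
qed

section \<open>Geometric growth of the heights\<close>

definition K :: nat where
  "K = 4 ^ (CARD('m) + CARD('n))"

lemma K_pos: "0 < K"
  by (simp add: K_def)

text \<open>
  Among \<open>K + 1\<close> consecutive best approximations two agree modulo 4; a quarter of their difference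
  is an integer point, and its height is at most half the larger height.
\<close>

lemma X_doubles: "2 * X j \<le> X (j + K)"
proof -
  let ?f = "\<lambda>i. (\<lambda>s. x i $ s mod 4, \<lambda>t. y i $ t mod 4)"
  let ?T = "(UNIV \<rightarrow>\<^sub>E {0..3 :: int}) \<times> (UNIV \<rightarrow>\<^sub>E {0..3 :: int}) :: (('m \<Rightarrow> int) \<times> ('n \<Rightarrow> int)) set"
  have "finite ?T"
    by (intro finite_cartesian_product finite_PiE) auto
  moreover have "?f ` {j..j + K} \<subseteq> ?T"
    by (auto simp: PiE_UNIV_domain)
  ultimately have "card (?f ` {j..j + K}) \<le> card ?T"
    by (rule card_mono)
  also have "\<dots> = K"
    by (simp add: card_cartesian_product card_PiE K_def power_add)
  finally have "\<not> inj_on ?f {j..j + K}"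
    by (intro pigeonhole) auto
  then obtain a b where ab: "j \<le> a" "a < b" "b \<le> j + K" and eq: "?f a = ?f b"
    unfolding inj_on_def by (metis atLeastAtMost_iff linorder_neqE_nat)
  define u where "u = (\<chi> s. (x b $ s - x a $ s) div 4)"
  define v where "v = (\<chi> t. (y b $ t - y a $ t) div 4)"
  have "x b $ s mod 4 = x a $ s mod 4" "y b $ t mod 4 = y a $ t mod 4" for s t
    using eq by (metis Pair_inject)+
  then have u: "4 *s u = x b - x a" and v: "4 *s v = y b - y a"
    by (simp_all add: u_def v_def vec_eq_iff mod_eq_dvd_iff)
  have "4 * height u = height (x b - x a)"
    unfolding u [symmetric] by (simp add: real_vec_scale infnorm_mul)
  also have "\<dots> \<le> X b + X a"
    unfolding real_vec_diff by (rule infnorm_diff_le)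
  finally have hu: "2 * height u \<le> X b"
    using X_less [of a b] ab by linarith
  have "4 * lin_err \<xi> u v = infnorm (err \<xi> (x b - x a) (y b - y a))"
    unfolding u [symmetric] v [symmetric] by (simp add: err_scale infnorm_mul lin_err_eq)
  also have "\<dots> \<le> L b + L a"
    unfolding err_diff infnorm_e [symmetric] by (rule infnorm_diff_le)
  finally have "lin_err \<xi> u v < L a"
    using L_less [of a b] L_pos [of a] ab by linarith
  moreover have "u \<noteq> 0"
  proof
    assume "u = 0"
    then have "x b = x a"
      using u by simp
    then show False
      using X_less [of a b] ab by simp
  qed
  \<comment> \<open>The new point has a smaller error than the approximation with index
    \<open>a\<close>, so its height cannot be below the next one.\<close>
  ultimately have "X (Suc a) \<le> height u"
    using eq_0_if_small(1) [of u a v] by (meson not_le)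
  moreover have "X j \<le> X (Suc a)" "X b \<le> X (j + K)"
    using ab by (simp_all add: X_le)
  ultimately show ?thesis
    using hu by linarith
qed

lemma X_ge_power: "2 ^ k \<le> X (k * K)"
proof (induction k)
  case (Suc k)
  then show ?case
    using X_doubles [of "k * K"] by (simp add: add.commute)
qed (simp add: height_0)

text \<open>Over \<open>K\<close> steps the height at least doubles and the error shrinks by at most
  the factor \<open>C ^ K\<close>; \<open>\<mu>\<close> is the exponent with
  \<open>2 powr \<mu> = C ^ K\<close>.\<close>

lemma L_ge_power: "\<exists>c \<mu>. 0 < c \<and> 0 \<le> \<mu> \<and> (\<forall>i. c * X i powr - \<mu> \<le> L i)"
proof (intro exI conjI allI)
  define \<mu> where "\<mu> = log 2 (C ^ K)"
  have CK: "1 \<le> C ^ K"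
    using C_ge_1 by simp
  then have \<mu>: "2 powr \<mu> = C ^ K"
    by (simp add: \<mu>_def)
  show "0 < L 0 / C ^ K"
    using L_pos CK by simp
  show "0 \<le> \<mu>"
    unfolding \<mu>_def using CK by simp
  fix i
  let ?q = "i div K"
  \<comment> \<open>Rounding \<open>i\<close> up to a multiple of \<open>K\<close> costs one extra
    factor \<open>C ^ K\<close>, which the constant \<open>L 0 / C ^ K\<close> absorbs.\<close>
  have "i \<le> 0 + K * Suc ?q"
    using K_pos by (metis add.left_neutral dividend_less_times_div less_or_eq_imp_le mult.commute mult_Suc_right)
  then have "L 0 \<le> C ^ (K * Suc ?q) * L i"
    by (intro L_ratio_power') auto
  also have "C ^ (K * Suc ?q) = C ^ K * (2 powr \<mu>) ^ ?q"
    by (simp add: \<mu> power_mult [symmetric] power_add)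
  also have "(2 powr \<mu>) ^ ?q = (2 ^ ?q) powr \<mu>"
    by (simp add: powr_realpow [symmetric] powr_powr mult.commute)
  also have "C ^ K * (2 ^ ?q) powr \<mu> * L i \<le> C ^ K * X i powr \<mu> * L i"
  proof -
    have "2 ^ ?q \<le> X i"
      using X_ge_power [of ?q] X_le [of "?q * K" i] by (simp add: order_trans)
    then show ?thesis
      using CK L_pos [of i] \<open>0 \<le> \<mu>\<close> by (intro mult_right_mono mult_left_mono powr_mono2) auto
  qed
  finally show "L 0 / C ^ K * X i powr - \<mu> \<le> L i"
    using CK X_pos [of i] by (simp add: powr_minus field_simps)
qed

section \<open>Parallel \<open>x\<close>-parts, and one column\<close>

text \<open>Eliminating the parallel \<open>x\<close>-parts leaves an integer vector
  \<open>v\<close>, nonzero by independence, whose height is an error of size at most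
  \<open>2 * X (Suc k) * L k\<close>. This serves one column directly and the degenerate case of two
  columns.\<close>

lemma height_parallel:
  assumes "\<And>s t. x k $ s * x (Suc k) $ t = x k $ t * x (Suc k) $ s"
  shows "1 \<le> 2 * X (Suc k) * L k"
proof -
  \<comment> \<open>A coordinate attaining the height makes \<open>p\<close> nonzero, which is what
    independence needs to give \<open>v \<noteq> 0\<close>.\<close>
  obtain s where s: "X (Suc k) = \<bar>real_vec (x (Suc k)) $ s\<bar>"
    by (rule infnorm_cart_attained)
  define p q where "p = x (Suc k) $ s" and "q = x k $ s"
  have p: "\<bar>real_of_int p\<bar> = X (Suc k)" and q: "\<bar>real_of_int q\<bar> \<le> X k"
    using s component_le_infnorm_cart [of "real_vec (x k)" s] by (simp_all add: p_def q_def)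
  have x: "p *s x k - q *s x (Suc k) = 0"
    using assms [of _ s] by (simp add: vec_eq_iff p_def q_def mult.commute)
  define v where "v = p *s y k - q *s y (Suc k)"
  have "p \<noteq> 0"
    using p X_pos [of "Suc k"] by auto
  then have "v \<noteq> 0"
    using consecutive_independent(1) [of p k q] x by (auto simp: v_def)
  then have "1 \<le> height v"
    using height_less_1 by (meson not_le)
  also have "height v = infnorm (real_of_int p *\<^sub>R e k - real_of_int q *\<^sub>R e (Suc k))"
    by (simp flip: lin_err_0 [of \<xi>] err_scale err_diff x add: lin_err_eq v_def)
  also have "\<dots> \<le> X (Suc k) * L k + \<bar>real_of_int q\<bar> * L (Suc k)"
    using infnorm_diff_le [of "real_of_int p *\<^sub>R e k" "real_of_int q *\<^sub>R e (Suc k)"]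
    by (simp add: infnorm_mul infnorm_e p)
  also have "\<bar>real_of_int q\<bar> * L (Suc k) \<le> X (Suc k) * L k"
    using q X_less [of k "Suc k"] L_le [of k "Suc k"] L_pos [of "Suc k"] by (intro mult_mono) auto
  finally show ?thesis
    by simp
qed

lemma L_ge_dim_1:
  assumes "CARD('m) = 1"
  shows "\<exists>c>0. \<forall>i. c * X i powr - 1 \<le> L i"
proof -
  have 1: "s = t" for s t :: 'm
    using assms by (metis UNIV_I card_1_singletonE singletonD)
  \<comment> \<open>\<open>L 0\<close> handles \<open>i = 0\<close>, where the height is 1; the
    other term comes from \<open>height_parallel\<close> at the preceding index and one use of
    property (C).\<close>
  define c where "c = min (L 0) (1 / (2 * C))"
  have "c \<le> X i * L i" for i
  proof (cases i)
    case 0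
    then show ?thesis
      by (simp add: height_0 c_def)
  next
    case (Suc k)
    have "1 \<le> 2 * X i * L k"
      unfolding Suc by (rule height_parallel) (metis 1)
    also have "\<dots> \<le> 2 * X i * (C * L i)"
      unfolding Suc using L_ratio [of k] X_pos [of "Suc k"] by (intro mult_left_mono) auto
    finally have "1 / (2 * C) \<le> X i * L i"
      using C_ge_1 by (simp add: field_simps)
    then show ?thesis
      by (simp add: c_def)
  qed
  moreover have "0 < c"
    using L_pos C_ge_1 by (simp add: c_def)
  ultimately show ?thesis
    using X_pos
    by (intro exI [of _ c]) (auto simp: powr_minus_divide abs_of_pos divide_le_eq mult.commute)
qed

section \<open>Lattices spanned by two consecutive best approximations\<close>

definition comb :: "nat \<Rightarrow> ((int ^ 'm) \<times> (int ^ 'n)) set" where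
  "comb k = {(a *s x k + b *s x (Suc k), a *s y k + b *s y (Suc k)) | a b. True}"

lemma combI: "u = a *s x k + b *s x (Suc k) \<Longrightarrow> v = a *s y k + b *s y (Suc k) \<Longrightarrow> (u, v) \<in> comb k"
  unfolding comb_def by blast

lemma combE:
  assumes "(u, v) \<in> comb k"
  obtains a b where "u = a *s x k + b *s x (Suc k)" "v = a *s y k + b *s y (Suc k)"
  using assms unfolding comb_def by blast

lemma mem_comb: "(x k, y k) \<in> comb k" "(x (Suc k), y (Suc k)) \<in> comb k"
  by (rule combI [of _ 1 _ 0]; simp add: vec_eq_iff) (rule combI [of _ 0 _ 1]; simp add: vec_eq_iff)

lemma comb_closed:
  assumes "(u, v) \<in> comb k" "(u', v') \<in> comb k"
  shows "(a *s u + b *s u', a *s v + b *s v') \<in> comb k"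
proof -
  obtain p q where p: "u = p *s x k + q *s x (Suc k)" "v = p *s y k + q *s y (Suc k)"
    using assms(1) by (rule combE)
  obtain p' q' where p': "u' = p' *s x k + q' *s x (Suc k)" "v' = p' *s y k + q' *s y (Suc k)"
    using assms(2) by (rule combE)
  show ?thesis
    by (rule combI [of _ "a * p + b * p'" _ "a * q + b * q'"])
      (simp_all add: p p' vec_eq_iff algebra_simps)
qed

text \<open>Neighbours form a basis of all integer points in their real plane. Rounding the
  coefficients leaves an integer point with coefficients at most 1/2, hence of height below
  \<open>X (Suc k)\<close> and error below \<open>L k\<close>, so it is zero.\<close>

lemma comb_if_small_rational:
  assumes u: "real_vec u = \<alpha> *\<^sub>R real_vec (x k) + \<beta> *\<^sub>R real_vec (x (Suc k))"
    and v: "err \<xi> u v = \<alpha> *\<^sub>R e k + \<beta> *\<^sub>R e (Suc k)"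
  shows "(u, v) \<in> comb k"
proof -
  define a b where "a = round \<alpha>" and "b = round \<beta>"
  define u' v' where "u' = u - (a *s x k + b *s x (Suc k))"
    and "v' = v - (a *s y k + b *s y (Suc k))"
  have a: "\<bar>\<alpha> - of_int a\<bar> \<le> 1 / 2" and b: "\<bar>\<beta> - of_int b\<bar> \<le> 1 / 2"
    using of_int_round_abs_le [of \<alpha>] of_int_round_abs_le [of \<beta>]
    by (simp_all add: a_def b_def abs_minus_commute)
  \<comment> \<open>Stated for any Euclidean space since it is applied both to
    \<open>x\<close>-parts and to error vectors.\<close>
  have bound: "infnorm ((\<alpha> - of_int a) *\<^sub>R w + (\<beta> - of_int b) *\<^sub>R w') \<le> (infnorm w + infnorm w') / 2"
    for w w' :: "'z :: euclidean_space"
  proof -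
    have "infnorm ((\<alpha> - of_int a) *\<^sub>R w + (\<beta> - of_int b) *\<^sub>R w') \<le>
        \<bar>\<alpha> - of_int a\<bar> * infnorm w + \<bar>\<beta> - of_int b\<bar> * infnorm w'"
      using infnorm_triangle [of "(\<alpha> - of_int a) *\<^sub>R w" "(\<beta> - of_int b) *\<^sub>R w'"]
      by (simp add: infnorm_mul)
    also have "\<dots> \<le> 1 / 2 * infnorm w + 1 / 2 * infnorm w'"
      using a b by (intro add_mono mult_right_mono infnorm_pos_le)
    finally show ?thesis
      by simp
  qed
  have "real_vec u' = (\<alpha> - of_int a) *\<^sub>R real_vec (x k) + (\<beta> - of_int b) *\<^sub>R real_vec (x (Suc k))"
    by (simp add: u'_def real_vec_diff real_vec_add real_vec_scale u algebra_simps)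
  then have "height u' \<le> (X k + X (Suc k)) / 2"
    by (simp only: bound)
  then have hu: "height u' < X (Suc k)"
    using X_less [of k "Suc k"] by simp
  have "err \<xi> u' v' = (\<alpha> - of_int a) *\<^sub>R e k + (\<beta> - of_int b) *\<^sub>R e (Suc k)"
    by (simp add: u'_def v'_def err_diff err_add err_scale v algebra_simps)
  then have "lin_err \<xi> u' v' \<le> (L k + L (Suc k)) / 2"
    unfolding infnorm_e [symmetric] lin_err_eq by (simp only: bound)
  then have "lin_err \<xi> u' v' < L k"
    using L_less [of k "Suc k"] by simp
  with hu have "u' = 0" "v' = 0"
    by (rule eq_0_if_small)+
  then show ?thesis
    by (intro combI [of _ a _ b]) (simp_all add: u'_def v'_def)
qed

text \<open>Cramer's rule expresses the third \<open>x\<close>-part by the first two. The same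
  combination of the \<open>y\<close>-parts is an integer vector whose height is a sum of three
  terms, each at most \<open>2 * X (Suc (Suc k)) * X (Suc k) * L k\<close>, hence below 1; so the
  relation holds for the full pairs.\<close>

lemma next_in_comb:
  assumes "CARD('m) = 2" and small: "6 * X (Suc (Suc k)) * X (Suc k) * L k < 1"
  shows "(x (Suc (Suc k)), y (Suc (Suc k))) \<in> comb k"
proof -
  let ?k1 = "Suc k" and ?k2 = "Suc (Suc k)"
  obtain s t :: 'm where st: "UNIV = {s, t}"
    using assms(1) by (metis card_2_iff)
  define D where "D i j = x i $ s * x j $ t - x i $ t * x j $ s" for i j
  have X_k1: "X k \<le> X ?k1" "X ?k1 \<le> X ?k2"
    by (simp_all add: X_le)
  have D_le: "\<bar>real_of_int (D i j)\<bar> \<le> 2 * (X i * X j)" for i j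
  proof -
    have "\<bar>real_of_int (x i $ a * x j $ b)\<bar> \<le> X i * X j" for a b
      using component_le_infnorm_cart [of "real_vec (x i)" a]
        component_le_infnorm_cart [of "real_vec (x j)" b]
      by (simp add: abs_mult mult_mono')
    from this [of s t] this [of t s] show ?thesis
      by (simp add: D_def)
  qed
  \<comment> \<open>The determinants of Cramer's rule; \<open>d\<close> is the denominator, and
    \<open>d = 0\<close> would mean parallel \<open>x\<close>-parts.\<close>
  define d p q where "d = D k ?k1" and "p = D ?k2 ?k1" and "q = D k ?k2"
  have "d \<noteq> 0"
  proof
    assume "d = 0"
    then have "x k $ i * x ?k1 $ j = x k $ j * x ?k1 $ i" for i j
    proof -
      have "i = s \<or> i = t" "j = s \<or> j = t"
        using st by auto
      then show ?thesis
        using \<open>d = 0\<close> by (elim disjE) (simp_all add: d_def D_def)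
    qed
    then have "1 \<le> 2 * X ?k1 * L k"
      by (rule height_parallel)
    also have "\<dots> \<le> (6 * X ?k2) * X ?k1 * L k"
      using X_ge_1 [of ?k2] X_pos [of ?k1] L_pos [of k] by (intro mult_right_mono) auto
    finally show False
      using small by simp
  qed
  have x0: "d *s x ?k2 - (p *s x k + q *s x ?k1) = 0"
    unfolding vec_eq_iff
  proof
    fix i
    have "i = s \<or> i = t"
      using st by auto
    then show "(d *s x ?k2 - (p *s x k + q *s x ?k1)) $ i = 0 $ i"
      by (auto simp: d_def p_def q_def D_def algebra_simps)
  qed
  define v where "v = d *s y ?k2 - (p *s y k + q *s y ?k1)"
  let ?w = "of_int d *\<^sub>R e ?k2 - (of_int p *\<^sub>R e k + of_int q *\<^sub>R e ?k1)"
  have v: "err \<xi> 0 v = ?w"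
    unfolding x0 [symmetric] v_def by (simp add: err_diff err_add err_scale)
  have "height v = infnorm ?w"
    using v by (simp flip: lin_err_0 [of \<xi>] add: lin_err_eq)
  also have "\<dots> \<le> infnorm (of_int d *\<^sub>R e ?k2) + (infnorm (of_int p *\<^sub>R e k) + infnorm (of_int q *\<^sub>R e ?k1))"
    by (intro order_trans [OF infnorm_diff_le] add_left_mono infnorm_triangle)
  also have "\<dots> = \<bar>of_int d\<bar> * L ?k2 + (\<bar>of_int p\<bar> * L k + \<bar>of_int q\<bar> * L ?k1)"
    by (simp add: infnorm_mul infnorm_e)
  also have "\<dots> \<le> 2 * (X ?k2 * X ?k1) * L k + (2 * (X ?k2 * X ?k1) * L k + 2 * (X ?k2 * X ?k1) * L k)"
  proof -
    have "X k * X ?k1 \<le> X ?k2 * X ?k1" "X k * X ?k2 \<le> X ?k2 * X ?k1"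
      using X_k1 X_pos [of k] X_pos [of ?k1] X_pos [of ?k2]
      by (simp_all add: mult.commute [of "X k"])
    then have "\<bar>of_int d\<bar> \<le> 2 * (X ?k2 * X ?k1)" "\<bar>of_int p\<bar> \<le> 2 * (X ?k2 * X ?k1)"
      "\<bar>of_int q\<bar> \<le> 2 * (X ?k2 * X ?k1)"
      using D_le [of k ?k1] D_le [of ?k2 ?k1] D_le [of k ?k2] unfolding d_def p_def q_def
      by linarith+
    then show ?thesis
      using L_pos by (intro add_mono mult_mono L_le) (auto intro: less_imp_le)
  qed
  finally have "height v < 1"
    using small by (simp add: mult_ac)
  then have "v = 0"
    by (rule height_less_1)
  with v have e: "of_int d *\<^sub>R e ?k2 = of_int p *\<^sub>R e k + of_int q *\<^sub>R e ?k1"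
    by (simp add: err_def)
  have x: "of_int d *\<^sub>R real_vec (x ?k2) = of_int p *\<^sub>R real_vec (x k) + of_int q *\<^sub>R real_vec (x ?k1)"
    using arg_cong [OF x0, of real_vec] by (simp add: real_vec_diff real_vec_add real_vec_scale)
  have div: "w = (of_int p / of_int d) *\<^sub>R w1 + (of_int q / of_int d) *\<^sub>R w2"
    if "of_int d *\<^sub>R w = of_int p *\<^sub>R w1 + of_int q *\<^sub>R w2" for w w1 w2 :: "'z :: real_vector"
  proof -
    have "w = (1 / of_int d) *\<^sub>R (of_int d *\<^sub>R w)"
      using \<open>d \<noteq> 0\<close> by simp
    then show ?thesis
      unfolding that by (simp add: scaleR_add_right)
  qed
  show ?thesis
    using div [OF x] div [OF e] by (rule comb_if_small_rational)
qed

section \<open>Mixed minors of consecutive approximations\<close>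

definition minor :: "'m \<Rightarrow> 'n \<Rightarrow> nat \<Rightarrow> real" where
  "minor s t i = of_int (x i $ s) * e (Suc i) $ t - of_int (x (Suc i) $ s) * e i $ t"

lemma minor_upper: "\<bar>minor s t i\<bar> \<le> 2 * X (Suc i) * L i"
proof -
  have "\<bar>of_int (x i $ s) * e (Suc i) $ t\<bar> \<le> X (Suc i) * L i"
    and "\<bar>of_int (x (Suc i) $ s) * e i $ t\<bar> \<le> X (Suc i) * L i"
    using component_le_infnorm_cart [of "real_vec (x i)" s] component_le_infnorm_cart [of "e i" t]
      component_le_infnorm_cart [of "real_vec (x (Suc i))" s]
      component_le_infnorm_cart [of "e (Suc i)" t] X_le [of i "Suc i"] L_le [of i "Suc i"]
    by (auto simp: abs_mult infnorm_e intro!: mult_mono')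
  then show ?thesis
    unfolding minor_def by linarith
qed

text \<open>Choosing \<open>s\<close> and \<open>t\<close> where \<open>x (Suc i)\<close> and
  \<open>e i\<close> attain their norms makes one product of the determinant as large as possible.
  The bound is useful when the height grows by a definite factor.\<close>

lemma minor_lower:
  obtains s t where "X (Suc i) * L i - X i * L (Suc i) \<le> \<bar>minor s t i\<bar>"
proof -
  obtain s where s: "X (Suc i) = \<bar>real_vec (x (Suc i)) $ s\<bar>"
    by (rule infnorm_cart_attained)
  obtain t where t: "infnorm (e i) = \<bar>e i $ t\<bar>"
    by (rule infnorm_cart_attained)
  have "\<bar>of_int (x i $ s) * e (Suc i) $ t\<bar> \<le> X i * L (Suc i)"
    using component_le_infnorm_cart [of "real_vec (x i)" s]
      component_le_infnorm_cart [of "e (Suc i)" t]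
    by (auto simp: abs_mult infnorm_e intro!: mult_mono')
  moreover have "\<bar>of_int (x (Suc i) $ s) * e i $ t\<bar> = X (Suc i) * L i"
    using s t by (simp add: abs_mult infnorm_e)
  ultimately show thesis
    by (intro that [of s t]) (auto simp: minor_def)
qed

text \<open>
  Two integer combinations of a pair have its minors multiplied by an integer, which here does not
  vanish because consecutive best approximations are independent.
\<close>

lemma minor_le_if_comb:
  assumes "(x i, y i) \<in> comb k" "(x (Suc i), y (Suc i)) \<in> comb k"
  shows "\<bar>minor s t k\<bar> \<le> \<bar>minor s t i\<bar>"
proof -
  obtain a b where a: "x i = a *s x k + b *s x (Suc k)" "y i = a *s y k + b *s y (Suc k)"
    using assms(1) by (rule combE)
  obtain c d where c: "x (Suc i) = c *s x k + d *s x (Suc k)" "y (Suc i) = c *s y k + d *s y (Suc k)"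
    using assms(2) by (rule combE)
  have "a * d - b * c \<noteq> 0"
  proof
    assume "a * d - b * c = 0"
    then have "d * a = b * c" "d * b = b * d" "c * a = a * c" "c * b = a * d"
      by (simp_all add: mult.commute)
    then have "d *s x i = b *s x (Suc i)" "d *s y i = b *s y (Suc i)"
      "c *s x i = a *s x (Suc i)" "c *s y i = a *s y (Suc i)"
      unfolding a c by (simp_all add: vec_eq_iff distrib_left flip: mult.assoc)
    then have "d = 0" "c = 0"
      by (metis consecutive_independent(1))+
    then have "x (Suc i) = 0"
      by (simp add: c vec_eq_iff)
    then show False
      using X_pos [of "Suc i"] by (simp add: infnorm_pos_lt)
  qed
  then have "1 \<le> \<bar>a * d - b * c\<bar>"
    by linarith
  then have *: "1 \<le> \<bar>real_of_int (a * d - b * c)\<bar>"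
    by linarith
  have "minor s t i = real_of_int (a * d - b * c) * minor s t k"
  proof -
    have "e i = of_int a *\<^sub>R e k + of_int b *\<^sub>R e (Suc k)"
      "e (Suc i) = of_int c *\<^sub>R e k + of_int d *\<^sub>R e (Suc k)"
      unfolding a c err_add err_scale by simp_all
    then show ?thesis
      by (simp add: minor_def a(1) c(1)) (simp add: algebra_simps)
  qed
  then show ?thesis
    using mult_right_mono [OF *, of "\<bar>minor s t k\<bar>"] by (simp add: abs_mult)
qed

section \<open>Steps of definite growth, and two columns\<close>

text \<open>Chosen with \<open>\<rho> ^ K = 3 / 2 < 2\<close>, so that \<open>K\<close> successive
  steps of ratio below \<open>\<rho>\<close> would contradict \<open>X_doubles\<close>.\<close>

definition \<rho> :: real where
  "\<rho> = root K (3 / 2)"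

lemma \<rho>_gt_1: "1 < \<rho>"
  using K_pos by (simp add: \<rho>_def)

text \<open>Supplies, within \<open>K\<close> steps, an index at which \<open>minor_lower\<close>
  loses only a constant factor.\<close>

lemma X_grows_nearby:
  obtains k where "j \<le> k" "k < j + K" "\<rho> * X k \<le> X (Suc k)"
proof (rule ccontr)
  assume "\<not> thesis"
  then have slow: "X (Suc k) < \<rho> * X k" if "j \<le> k" "k < j + K" for k
    using \<open>\<And>k. j \<le> k \<Longrightarrow> k < j + K \<Longrightarrow> \<rho> * X k \<le> X (Suc k) \<Longrightarrow> thesis\<close> that
    by (meson not_le)
  have "X (j + r) \<le> \<rho> ^ r * X j" if "r \<le> K" for r
    using that
  proof (induction r)
    case (Suc r)
    have "X (Suc (j + r)) \<le> \<rho> * X (j + r)"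
      using slow [of "j + r"] Suc.prems by simp
    also have "\<dots> \<le> \<rho> * (\<rho> ^ r * X j)"
      using Suc \<rho>_gt_1 by (intro mult_left_mono) auto
    finally show ?case
      by (simp add: mult.assoc)
  qed simp
  from this [of K] have "X (j + K) \<le> 3 / 2 * X j"
    using K_pos by (simp add: \<rho>_def)
  then show False
    using X_doubles [of j] X_pos [of j] by linarith
qed

text \<open>Compares the two ends of a block in a plane: some minor at an index \<open>k\<close>
  near \<open>j\<close> is large, all later approximations of the block lie in
  \<open>comb k\<close>, so the minor at \<open>i\<close> is at least as large, and
  \<open>minor_upper\<close> bounds it.\<close>

lemma L_ge_if_comb:
  assumes "\<And>k. j \<le> k \<Longrightarrow> Suc k \<le> i \<Longrightarrow> (x (Suc (Suc k)), y (Suc (Suc k))) \<in> comb k"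
    and "j + K \<le> i"
  shows "(1 - 1 / \<rho>) * X (Suc j) * L j \<le> 2 * C ^ K * X (Suc i) * L i"
proof -
  obtain k where k: "j \<le> k" "k < j + K" "\<rho> * X k \<le> X (Suc k)"
    by (rule X_grows_nearby)
  have "(x (k + r), y (k + r)) \<in> comb k \<and> (x (Suc (k + r)), y (Suc (k + r))) \<in> comb k"
    if "k + r \<le> i" for r
    using that
  proof (induction r)
    case 0
    show ?case
      by (simp add: mem_comb)
  next
    case (Suc r)
    then have "(x (Suc (Suc (k + r))), y (Suc (Suc (k + r)))) \<in> comb (k + r)"
      using k by (intro assms(1)) auto
    then obtain a b where "x (Suc (Suc (k + r))) = a *s x (k + r) + b *s x (Suc (k + r))"
      "y (Suc (Suc (k + r))) = a *s y (k + r) + b *s y (Suc (k + r))"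
      by (rule combE)
    then show ?case
      using Suc comb_closed by simp
  qed
  from this [of "i - k"] have "(x i, y i) \<in> comb k" "(x (Suc i), y (Suc i)) \<in> comb k"
    using k assms(2) by simp_all
  then have *: "\<bar>minor s t k\<bar> \<le> 2 * X (Suc i) * L i" for s t
    using minor_le_if_comb minor_upper order_trans by blast
  obtain s t where st: "X (Suc k) * L k - X k * L (Suc k) \<le> \<bar>minor s t k\<bar>"
    by (rule minor_lower)
  \<comment> \<open>Moving from \<open>j\<close> to \<open>k\<close> takes fewer than
    \<open>K\<close> steps, so property (C) costs at most \<open>C ^ K\<close>.\<close>
  have "X (Suc j) * L j \<le> X (Suc k) * (C ^ K * L k)"
    using k by (intro mult_mono X_le L_ratio_power') (auto intro: less_imp_le L_pos infnorm_pos_le)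
  then have "(1 - 1 / \<rho>) * (X (Suc j) * L j) \<le> (1 - 1 / \<rho>) * (X (Suc k) * (C ^ K * L k))"
    using \<rho>_gt_1 by (intro mult_left_mono) auto
  also have "\<dots> = C ^ K * (X (Suc k) * L k - X (Suc k) / \<rho> * L k)"
    by (simp add: algebra_simps)
  also have "\<dots> \<le> C ^ K * (X (Suc k) * L k - X k * L (Suc k))"
  proof -
    have "X k \<le> X (Suc k) / \<rho>"
      using k(3) \<rho>_gt_1 by (simp add: field_simps)
    then have "X k * L (Suc k) \<le> X (Suc k) / \<rho> * L k"
      using L_pos [of "Suc k"] X_pos [of k] L_le [of k "Suc k"] by (intro mult_mono) auto
    then show ?thesis
      using C_ge_1 by (intro mult_left_mono) auto
  qed
  also have "\<dots> \<le> C ^ K * (2 * X (Suc i) * L i)"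
    using C_ge_1 st * [of s t] by (intro mult_left_mono) auto
  finally show ?thesis
    by (simp add: mult_ac)
qed

lemma L_ge_dim_2:
  assumes "CARD('m) = 2"
  shows "\<exists>c>0. \<forall>i. c * X i powr - 2 \<le> L i"
proof -
  \<comment> \<open>\<open>c0\<close> bounds the product at the start of a block: \<open>L 0\<close>
    if the block starts at 0, else \<open>1 / (6 * C)\<close> from \<open>next_in_comb\<close> and
    property (C). The factors in \<open>c\<close> are the losses of \<open>L_ge_if_comb\<close> and
    of the last step to \<open>i\<close>.\<close>
  define c0 where "c0 = min (L 0) (1 / (6 * C))"
  define c where "c = c0 * (1 - 1 / \<rho>) / (2 * C * C ^ K)"
  have \<rho>: "0 < 1 - 1 / \<rho>" "1 - 1 / \<rho> \<le> 1"
    using \<rho>_gt_1 by simp_all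
  have c0: "0 < c0"
    using L_pos C_ge_1 by (simp add: c0_def)
  have CK: "1 \<le> C ^ K"
    using C_ge_1 by simp
  have "1 - 1 / \<rho> \<le> 2 * C"
    using \<rho>(2) C_ge_1 by linarith
  then have "(1 - 1 / \<rho>) / (2 * C) \<le> 1"
    using C_ge_1 by (simp add: divide_le_eq)
  then have "c0 * ((1 - 1 / \<rho>) / (2 * C)) \<le> c0 * 1"
    using c0 by (intro mult_left_mono) auto
  moreover have "c * C ^ K = c0 * ((1 - 1 / \<rho>) / (2 * C))"
    using CK by (simp add: c_def)
  ultimately have c_le: "c * C ^ K \<le> c0"
    by simp
  have c: "0 < c"
    using c0 C_ge_1 \<rho> by (simp add: c_def)
  have "c \<le> L i * X i ^ 2" for i
  proof (cases i)
    case 0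
    have "c * 1 \<le> c * C ^ K"
      using c CK by (intro mult_left_mono) auto
    then show ?thesis
      using c_le by (simp add: 0 height_0 c0_def)
  next
    case (Suc i')
    \<comment> \<open>\<open>P j\<close> says that the approximations from \<open>j\<close> to
      \<open>i = Suc i'\<close> lie in one plane. It is vacuous at \<open>i'\<close>, and the least
      such \<open>j\<close> gives the longest block.\<close>
    define P where "P j \<longleftrightarrow> (\<forall>k. j \<le> k \<longrightarrow> Suc k \<le> i' \<longrightarrow>
      (x (Suc (Suc k)), y (Suc (Suc k))) \<in> comb k)" for j
    define j where "j = (LEAST j. P j)"
    have "P i'"
      by (simp add: P_def)
    then have j: "P j" "j \<le> i'"
      unfolding j_def by (auto intro: LeastI Least_le)
    have start: "c0 \<le> X j * X (Suc j) * L j"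
    proof (cases j)
      case 0
      then show ?thesis
        using X_ge_1 [of "Suc 0"] L_pos [of 0] by (simp add: height_0 c0_def min.coboundedI1)
    next
      case (Suc k)
      \<comment> \<open>Since \<open>P j\<close> holds and \<open>P k\<close> fails for
        \<open>k = j - 1\<close>, the failure occurs exactly at \<open>k\<close>, and
        \<open>next_in_comb\<close> applies in contrapositive form.\<close>
      then have "\<not> P k"
        unfolding j_def by (metis lessI not_less_Least)
      then obtain l where "k \<le> l" "Suc l \<le> i'" "(x (Suc (Suc l)), y (Suc (Suc l))) \<notin> comb l"
        unfolding P_def by blast
      then have "(x (Suc j), y (Suc j)) \<notin> comb k"
        using j(1) Suc unfolding P_def by (metis le_antisym not_less_eq_eq)
      then have "1 \<le> 6 * X (Suc j) * X j * L k"
        using next_in_comb [OF assms, of k] Suc by force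
      also have "\<dots> \<le> 6 * X (Suc j) * X j * (C * L j)"
        using L_ratio [of k] Suc X_pos by (intro mult_left_mono) (auto intro: less_imp_le)
      finally have "1 / (6 * C) \<le> X j * X (Suc j) * L j"
        using C_ge_1 by (simp add: field_simps)
      then show ?thesis
        by (simp add: c0_def min.coboundedI2)
    qed
    have Xj: "X j \<le> X i" "X (Suc j) \<le> X i"
      using j(2) Suc by (simp_all add: X_le)
    show ?thesis
    proof (cases "j + K \<le> i'")
      case True
      have "(1 - 1 / \<rho>) * c0 \<le> (1 - 1 / \<rho>) * (X j * X (Suc j) * L j)"
        using start \<rho> by (intro mult_left_mono) auto
      also have "\<dots> = X j * ((1 - 1 / \<rho>) * X (Suc j) * L j)"
        by (simp add: mult_ac)
      also have "\<dots> \<le> X i * (2 * C ^ K * X i * L i')"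
      proof (rule mult_mono)
        show "(1 - 1 / \<rho>) * X (Suc j) * L j \<le> 2 * C ^ K * X i * L i'"
          unfolding Suc using j(1) by (intro L_ge_if_comb [OF _ True]) (simp add: P_def)
        show "0 \<le> (1 - 1 / \<rho>) * X (Suc j) * L j"
          using \<rho> X_pos [of "Suc j"] L_pos [of j] by (intro mult_nonneg_nonneg) auto
      qed (use Xj X_pos [of i] in auto)
      also have "\<dots> \<le> X i * (2 * C ^ K * X i * (C * L i))"
        using L_ratio [of i'] Suc X_pos [of i] CK by (intro mult_left_mono) auto
      finally show ?thesis
        using C_ge_1 by (simp add: c_def field_simps power2_eq_square)
    next
      \<comment> \<open>The block is short: \<open>i \<le> j + K\<close>, so property (C) alone
        compares \<open>L j\<close> with \<open>L i\<close>.\<close>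
      case False
      have "c * C ^ K \<le> X j * X (Suc j) * L j"
        using c_le start by simp
      also have "\<dots> \<le> X i * X i * (C ^ K * L i)"
        using Xj j(2) False Suc X_pos L_pos
        by (intro mult_mono L_ratio_power') (auto intro: less_imp_le)
      finally show ?thesis
        using CK by (simp add: power2_eq_square mult_ac)
    qed
  qed
  then have "c * X i powr - 2 \<le> L i" for i
    using X_pos [of i] by (simp add: powr_minus_divide divide_le_eq)
  with c show ?thesis
    by blast
qed

section \<open>From error bounds to the exponent\<close>

lemma X_unbounded: "\<exists>i. Z < X i"
proof -
  obtain k :: nat where "Z < 2 ^ k"
    using real_arch_pow [of 2 Z] by auto
  with X_ge_power show ?thesis
    by (meson less_le_trans)
qed

text \<open>Between \<open>X i\<close> and \<open>X (Suc i)\<close> no error is below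
  \<open>L i\<close>, hence none is below \<open>c * Z powr - \<mu>\<close>. An exponent
  \<open>w > \<mu>\<close> would then need \<open>c < Z powr (\<mu> - w)\<close>, which fails for
  large \<open>Z\<close>.\<close>

lemma ordinary_exponent_le:
  assumes c: "0 < c" and \<mu>: "0 \<le> \<mu>" and L_ge: "\<And>i. c * X i powr - \<mu> \<le> L i"
  shows "ordinary_exponent \<xi> \<le> ereal \<mu>"
proof -
  have "w \<le> \<mu>"
    if freq: "\<exists>\<^sub>F Z in at_top. \<exists>u v. lin_err \<xi> u v < Z powr - w \<and> 0 < height u \<and> height u \<le> Z" for w
  proof (rule ccontr)
    assume "\<not> w \<le> \<mu>"
    then have "((\<lambda>Z. Z powr (\<mu> - w)) \<longlongrightarrow> 0) at_top"
      by (intro tendsto_neg_powr filterlim_ident) auto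
    then have "\<forall>\<^sub>F Z in at_top. Z powr (\<mu> - w) < c"
      using c by (rule order_tendstoD)
    then have "\<forall>\<^sub>F Z in at_top. Z powr (\<mu> - w) < c \<and> 1 \<le> Z"
      using eventually_ge_at_top by (rule eventually_conj)
    then obtain Z u v where Z: "Z powr (\<mu> - w) < c" "1 \<le> Z"
      and uv: "lin_err \<xi> u v < Z powr - w" "0 < height u" "height u \<le> Z"
      using frequently_ex [OF frequently_eventually_conj [OF freq]] by blast
    \<comment> \<open>The step containing \<open>Z\<close>; its left end is at most \<open>Z\<close>
      by minimality, or by \<open>1 \<le> Z\<close> when \<open>i = 0\<close>.\<close>
    define i where "i = (LEAST i. Z < X (Suc i))"
    obtain k where "Z < X k"
      using X_unbounded by blast
    then have "Z < X (Suc k)"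
      using X_less [of k "Suc k"] by simp
    then have up: "Z < X (Suc i)"
      unfolding i_def by (rule LeastI)
    have lo: "X i \<le> Z"
    proof (cases i)
      case 0
      then show ?thesis
        using Z(2) by (simp add: height_0)
    next
      case (Suc k)
      then show ?thesis
        unfolding i_def by (metis lessI not_less not_less_Least)
    qed
    have "c * Z powr - \<mu> \<le> c * X i powr - \<mu>"
      using c lo \<mu> X_pos [of i] by (intro mult_left_mono powr_mono2') auto
    also have "\<dots> \<le> L i"
      by (rule L_ge)
    also have "\<dots> \<le> lin_err \<xi> u v"
      unfolding L_def using uv up by (intro best) auto
    finally have "c * Z powr - \<mu> < Z powr - w"
      using uv(1) by simp
    then have "c * Z powr - \<mu> * Z powr \<mu> < Z powr - w * Z powr \<mu>"
      using Z(2) by (intro mult_strict_right_mono) auto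
    then have "c < Z powr (\<mu> - w)"
      using Z(2) by (simp add: mult.assoc flip: powr_add)
    with Z(1) show False
      by simp
  qed
  then show ?thesis
    unfolding ordinary_exponent_def by (intro Sup_least) auto
qed

end

section \<open>Best approximations at the jump points\<close>

lemma jump_point_ge_1: "totally_irrational \<xi> \<Longrightarrow> 1 \<le> jump_point \<xi> i"
proof (induction i)
  case (Suc i)
  then show ?case
    using Least_jump(1) [of \<xi> "jump_point \<xi> i"] by simp
qed simp

text \<open>A minimiser has exactly the height of the jump point: a lower one could not improve on
  the previous value, and for \<open>i = 0\<close> a positive height is at least 1.\<close>

lemma jump_attained:
  assumes irr: "totally_irrational \<xi>"
  shows "\<exists>x y. height x = jump_point \<xi> i \<and> lin_err \<xi> x y = jump_val \<xi> i"
proof -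
  obtain u v where uv: "0 < height u" "height u \<le> jump_point \<xi> i"
    "min_err \<xi> (jump_point \<xi> i) = lin_err \<xi> u v"
    by (rule min_err_attained [OF jump_point_ge_1 [OF irr, of i]])
  have "\<not> height u < jump_point \<xi> i"
  proof
    assume less: "height u < jump_point \<xi> i"
    show False
    proof (cases i)
      case 0
      then show ?thesis
        using less uv(1) height_less_1 [of u] by (simp add: infnorm_pos_lt)
    next
      case (Suc k)
      note jump = Least_jump [OF irr jump_point_ge_1 [OF irr, of k]]
      have "min_err \<xi> (jump_point \<xi> k) \<le> lin_err \<xi> u v"
        using less Suc by (intro jump(3) uv(1)) simp
      then show ?thesis
        using jump(2) uv(3) Suc by simp
    qed
  qed
  with uv show ?thesis
    by (metis jump_val_def order_less_le)
qed

lemma best_approximations_exist: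
  assumes irr: "totally_irrational \<xi>" and "property_C \<xi>"
  obtains x y C where "best_approximations \<xi> x y C"
proof -
  obtain x y where x: "\<And>i. height (x i) = jump_point \<xi> i"
    and y: "\<And>i. lin_err \<xi> (x i) (y i) = jump_val \<xi> i"
    using jump_attained [OF irr] by metis
  obtain C where C: "\<And>i. jump_val \<xi> i / jump_val \<xi> (Suc i) \<le> C"
    using assms(2) by (auto simp: property_C_def bdd_above_def)
  note jump = Least_jump [OF irr jump_point_ge_1 [OF irr]]
  have pos: "0 < jump_val \<xi> i" for i
    unfolding jump_val_def by (rule min_err_pos [OF irr jump_point_ge_1 [OF irr]])
  have "best_approximations \<xi> x y C"
  proof
    fix i u v
    show "height (x 0) = 1" "lin_err \<xi> (x 0) (y 0) < 1" "0 < lin_err \<xi> (x i) (y i)"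
      by (simp_all add: x y pos jump_val_def min_err_1_less_1) (simp flip: jump_val_def add: pos)
    show "height (x i) < height (x (Suc i))"
      using jump(1) [of i] by (simp add: x)
    show "lin_err \<xi> (x (Suc i)) (y (Suc i)) < lin_err \<xi> (x i) (y i)"
      using jump(2) [of i] by (simp add: y jump_val_def)
    show "lin_err \<xi> (x i) (y i) \<le> C * lin_err \<xi> (x (Suc i)) (y (Suc i))"
      using C [of i] pos [of "Suc i"] by (simp add: y divide_le_eq)
    show "lin_err \<xi> (x i) (y i) \<le> lin_err \<xi> u v"
      if "0 < height u" "height u < height (x (Suc i))"
      using jump(3) [of u i v] that by (simp add: x y jump_val_def)
  qed
  then show thesis
    by (rule that)
qed

theorem theorem6:
  fixes \<xi> :: "real ^ 'm ^ 'n"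
  assumes "totally_irrational \<xi>" and "property_C \<xi>"
  shows "(CARD('n) \<ge> 2 \<and> CARD('m) = 1 \<longrightarrow> ordinary_exponent \<xi> \<le> 1) \<and>
         (CARD('n) \<ge> 2 \<and> CARD('m) = 2 \<longrightarrow> ordinary_exponent \<xi> \<le> 2) \<and>
         (CARD('n) \<ge> 2 \<and> CARD('m) \<ge> 3 \<longrightarrow> ordinary_exponent \<xi> < \<infinity>)"
proof -
  obtain x y C where "best_approximations \<xi> x y C"
    by (rule best_approximations_exist [OF assms])
  then interpret best_approximations \<xi> x y C .
  have "ordinary_exponent \<xi> \<le> 1" if "CARD('m) = 1"
    using L_ge_dim_1 [OF that] ordinary_exponent_le [of _ 1] by (auto simp: one_ereal_def)
  moreover have "ordinary_exponent \<xi> \<le> 2" if "CARD('m) = 2"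
    using L_ge_dim_2 [OF that] ordinary_exponent_le [of _ 2] by auto
  moreover obtain \<mu> where "ordinary_exponent \<xi> \<le> ereal \<mu>"
    using L_ge_power ordinary_exponent_le by metis
  then have "ordinary_exponent \<xi> < \<infinity>"
    by (rule le_less_trans) simp
  ultimately show ?thesis
    by blast
qed

end
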